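(* Let $\mathcal{P}\in\mathcal{P}_{n,m}$ be an adversarial strategy. Let $\boldsymbol{\ell}=\boldsymbol{\ell}(\mathrm{BL},\mathcal{P})$, let $\boldsymbol{\ell}^\circ\in\mathbb{Z}_{\ge0}^m$ be its conjugate load vector, and set $\boldsymbol{\ell}^\circ(0)=n$. Let $\widehat{\mathcal{P}}$ be the adversarial strategy that, regardless of the history of play, presents the following fixed sequence of polymatroids: for $j=1,2,\dots,m$ in order, $\boldsymbol{\ell}^\circ(j)$ consecutive copies of the discrete polymatroid with rank function $A\mapsto \mathbf{1}\{A\cap[\boldsymbol{\ell}^\circ(j-1)]\ne\emptyset\}$. Then $\widehat{\mathcal{P}}\in\mathcal{P}_{n,m}$, $\widehat{\mathcal{P}}$ is a nested strategy, and $$\boldsymbol{\ell}(\mathrm{BL},\mathcal{P})\sim\boldsymbol{\ell}(\mathrm{BL},\widehat{\mathcal{P}})\qquad\text{and}\qquad \mathrm{OPT}(\mathrm{BL},\mathcal{P})\succeq\mathrm{OPT}(\mathrm{BL},\widehat{\mathcal{P}}).$$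
   Context: **Notation.** $[n]=\{1,\dots,n\}$; for a vector $\mathbf{x}$ indexed by $[n]$ and $A\subseteq[n]$, $\mathbf{x}(A)=\sum_{i\in A}\mathbf{x}(i)$. **Discrete polymatroids.** A rank function is $r:2^{[n]}\to\mathbb{Z}_{\ge 0}$ that is normalized ($r(\emptyset)=0$), monotone ($r(A)\le r(B)$ for $A\subseteq B$) and submodular ($r(A)+r(B)\ge r(A\cap B)+r(A\cup B)$). It defines the discrete polymatroid $P=\{\mathbf{x}\in\mathbb{Z}_{\ge0}^n : \mathbf{x}(A)\le r(A)\ \forall A\subseteq[n]\}$, with $\mathrm{Rank}(P)=r([n])$ and $\mathrm{Bases}(P)=\{\mathbf{x}\in P:\mathbf{x}([n])=r([n])\}$. **Game.** On round $t=1,2,\dots$ the adversary presents a discrete polymatroid $P_t$ on $[n]$; the algorithm designer then irrevocably selects a basis $\mathbf{x}_t\in\mathrm{Bases}(P_t)$. The game ends after a finite number $h$ of rounds, when $\sum_{t=1}^h \mathrm{Rank}(P_t)=m$ exactly. An adversarial strategy $\mathcal{P}$ deterministically maps the history of play (all previous polymatroids and selected bases) to the next polymatroid; $\mathcal{P}_{n,m}$ is the set of adversarial strategies for $n$ agents and $m$ resources (against every designer strategy, the total rank presented is exactly $m$). An allocation strategy $\mathcal{A}$ maps, possibly at random, a history of play and the currently presented polymatroid to a basis of that polymatroid. The profile $(\mathcal{A},\mathcal{P})$ induces a (possibly random) sequence of polymatroids $(P_t)_{t\in[h]}$ and bases $(\mathbf{x}_t)_{t\in[h]}$; set $\boldsymbol{\ell}(\mathcal{A},\mathcal{P})=\sum_{t\in[h]}\mathbf{x}_t$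 (the load vector) and $H(\mathcal{A},\mathcal{P})=\{\sum_{t\in[h]}\mathbf{z}_t:\mathbf{z}_t\in\mathrm{Bases}(P_t)\}$. **Majorization.** For $\mathbf{x},\mathbf{y}\in\mathbb{Z}_{\ge0}^n$ with $\mathbf{x}([n])=\mathbf{y}([n])$, write $\mathbf{x}\succeq\mathbf{y}$ (equivalently $\mathbf{y}\preceq\mathbf{x}$) when $\mathbf{x}^{\uparrow}([k])\le\mathbf{y}^{\uparrow}([k])$ for all $k\in[n]$, where $\mathbf{x}^\uparrow(i)$ is the $i$-th smallest entry of $\mathbf{x}$. Write $\mathbf{x}\sim\mathbf{y}$ when $\mathbf{x}\preceq\mathbf{y}$ and $\mathbf{x}\succeq\mathbf{y}$, i.e. $\mathbf{x}$ and $\mathbf{y}$ are equal up to permutation of coordinates. **Hindsight optimum.** $\mathrm{OPT}(\mathcal{A},\mathcal{P})$ denotes a majorization-minimal element of $H(\mathcal{A},\mathcal{P})$, i.e. $\boldsymbol{\ell}^*\in H(\mathcal{A},\mathcal{P})$ with $\boldsymbol{\ell}^*\preceq\boldsymbol{\ell}$ for all $\boldsymbol{\ell}\in H(\mathcal{A},\mathcal{P})$ (it always exists and is unique up to permutation). **Brick-Laying.** $\mathrm{BL}$ is the deterministic strategy which, on round $t$ with current load $\boldsymbol{\ell}_{t-1}=\sum_{s<t}\mathbf{x}_s$, selects an $\mathbf{x}_t\in\mathrm{Bases}(P_t)$ with $\boldsymbol{\ell}_{t-1}+\mathbf{x}_t\preceq\boldsymbol{\ell}_{t-1}+\mathbf{x}$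 for all $\mathbf{x}\in\mathrm{Bases}(P_t)$ (such a basis always exists), ties broken by some deterministic rule. It is assumed that when presented with a rank-$1$ polymatroid, $\mathrm{BL}$ breaks ties in favor of agents with lower index: it selects the standard basis vector $\chi_i$ where $i$ is the smallest index minimizing $\boldsymbol{\ell}_{t-1}(i)$ over $\{i:\chi_i\in\mathrm{Bases}(P_t)\}$. **Conjugate.** For $\boldsymbol{\ell}\in\mathbb{Z}_{\ge0}^n$ with $\boldsymbol{\ell}([n])=m$, the conjugate $\boldsymbol{\ell}^\circ\in\mathbb{Z}_{\ge0}^m$ is $\boldsymbol{\ell}^\circ(j)=|\{i\in[n]:\boldsymbol{\ell}(i)\ge j\}|$, $j\in[m]$. **Nested strategy.** $\mathcal{P}\in\mathcal{P}_{n,m}$ is nested if, for every allocation strategy $\mathcal{A}$, with probability $1$ the profile $(\mathcal{A},\mathcal{P})$ induces a polymatroid sequence $P_1,\dots,P_m$ whose rank functions have the form $r_t(A)=\mathbf{1}\{A\cap N_t\neq\emptyset\}$ with $N_1\supseteq\dots\supseteq N_m$. *)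

theory Defs
  imports "HOL-Probability.Probability_Mass_Function"
begin

text \<open>
  Vectors indexed by \<open>[n] = {1..n}\<close> are functions vanishing outside \<open>{1..n}\<close>.
  A rank function on subsets of \<open>[n]\<close> is extended to all sets of naturals by
  \<open>r A = r (A \<inter> [n])\<close>, so that it is still determined by its values on subsets of \<open>[n]\<close>.
  Discrete polymatroids on \<open>[n]\<close> correspond bijectively to their rank functions
  (\<open>r A\<close> is the maximum of \<open>sum x A\<close> over the polymatroid); the adversary is modelled as
  presenting the rank function.
\<close>

type_synonym agent_vec = "nat \<Rightarrow> nat"
type_synonym rank_fun = "nat set \<Rightarrow> nat"
type_synonym history = "(rank_fun \<times> agent_vec) list"
type_synonym adversary = "history \<Rightarrow> rank_fun"
type_synonym det_allocation = "history \<Rightarrow> rank_fun \<Rightarrow> agent_vec"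
type_synonym allocation = "history \<Rightarrow> rank_fun \<Rightarrow> agent_vec pmf"

definition rank_function :: "nat \<Rightarrow> rank_fun \<Rightarrow> bool" where
  "rank_function n r \<longleftrightarrow>
     (\<forall>A. r A = r (A \<inter> {1..n})) \<and>
     r {} = 0 \<and>
     (\<forall>A B. A \<subseteq> B \<and> B \<subseteq> {1..n} \<longrightarrow> r A \<le> r B) \<and>
     (\<forall>A B. A \<subseteq> {1..n} \<and> B \<subseteq> {1..n} \<longrightarrow> r A + r B \<ge> r (A \<inter> B) + r (A \<union> B))"

definition polymatroid :: "nat \<Rightarrow> rank_fun \<Rightarrow> agent_vec set" where
  "polymatroid n r =
     {x. (\<forall>i. i \<notin> {1..n} \<longrightarrow> x i = 0) \<and> (\<forall>A \<subseteq> {1..n}. sum x A \<le> r A)}"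

definition bases :: "nat \<Rightarrow> rank_fun \<Rightarrow> agent_vec set" where
  "bases n r = {x \<in> polymatroid n r. sum x {1..n} = r {1..n}}"

definition unit_vec :: "nat \<Rightarrow> agent_vec" where
  "unit_vec i = (\<lambda>k. if k = i then 1 else 0)"

definition hitting_rank :: "nat set \<Rightarrow> rank_fun" where
  "hitting_rank N = (\<lambda>A. if A \<inter> N \<noteq> {} then 1 else 0)"

definition increasing_entries :: "nat \<Rightarrow> agent_vec \<Rightarrow> nat list" where
  "increasing_entries n x = sort (map x [1..<Suc n])"

text \<open>\<open>majorizes n x y\<close> is \<open>x \<succeq> y\<close>: the smallest \<open>k\<close> entries of \<open>x\<close> sum to at most those of \<open>y\<close>.\<close>

definition majorizes :: "nat \<Rightarrow> agent_vec \<Rightarrow> agent_vec \<Rightarrow> bool" where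
  "majorizes n x y \<longleftrightarrow>
     sum x {1..n} = sum y {1..n} \<and>
     (\<forall>k\<in>{1..n}. sum_list (take k (increasing_entries n x))
               \<le> sum_list (take k (increasing_entries n y)))"

definition majorization_equiv :: "nat \<Rightarrow> agent_vec \<Rightarrow> agent_vec \<Rightarrow> bool" where
  "majorization_equiv n x y \<longleftrightarrow> majorizes n x y \<and> majorizes n y x"

definition total_rank :: "nat \<Rightarrow> history \<Rightarrow> nat" where
  "total_rank n h = (\<Sum>(r, x)\<leftarrow>h. r {1..n})"

definition load :: "history \<Rightarrow> agent_vec" where
  "load h = (\<lambda>i. \<Sum>(r, x)\<leftarrow>h. x i)"

definition allocation_strategies :: "nat \<Rightarrow> allocation set" where
  "allocation_strategies n =
     {A. \<forall>h r. rank_function n r \<longrightarrow> set_pmf (A h r) \<subseteq> bases n r}"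

text \<open>
  Distribution of the history after \<open>k\<close> rounds. The game stops as soon as the presented
  ranks sum to \<open>m\<close>; from then on the history stays constant.
\<close>

primrec play :: "nat \<Rightarrow> nat \<Rightarrow> allocation \<Rightarrow> adversary \<Rightarrow> nat \<Rightarrow> history pmf" where
  "play n m A P 0 = return_pmf []"
| "play n m A P (Suc k) =
     bind_pmf (play n m A P k)
       (\<lambda>h. if total_rank n h = m then return_pmf h
            else map_pmf (\<lambda>x. h @ [(P h, x)]) (A h (P h)))"

text \<open>
  With probability 1, the game ends after finitely many rounds and its complete history
  satisfies \<open>Q\<close>. The events below increase with \<open>k\<close>, so by continuity of measure
  the limit is the probability of this happening at some finite round.
\<close>

definition almost_surely :: "nat \<Rightarrow> nat \<Rightarrow> allocation \<Rightarrow> adversary \<Rightarrow> (history \<Rightarrow> bool) \<Rightarrow> bool" where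
  "almost_surely n m A P Q \<longleftrightarrow>
     (\<lambda>k. measure_pmf.prob (play n m A P k) {h. total_rank n h = m \<and> Q h}) \<longlonglongrightarrow> 1"

definition adversarial_strategies :: "nat \<Rightarrow> nat \<Rightarrow> adversary set" where
  "adversarial_strategies n m =
     {P. \<forall>A \<in> allocation_strategies n.
           almost_surely n m A P (\<lambda>h. \<forall>(r, x)\<in>set h. rank_function n r)}"

definition nested_strategy :: "nat \<Rightarrow> nat \<Rightarrow> adversary \<Rightarrow> bool" where
  "nested_strategy n m P \<longleftrightarrow>
     (\<forall>A \<in> allocation_strategies n.
        almost_surely n m A P (\<lambda>h. length h = m \<and>
          (\<exists>N. (\<forall>t<m. N t \<subseteq> {1..n} \<and> fst (h ! t) = hitting_rank (N t)) \<and>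
               (\<forall>s t. s \<le> t \<and> t < m \<longrightarrow> N t \<subseteq> N s))))"

definition deterministic :: "det_allocation \<Rightarrow> allocation" where
  "deterministic b = (\<lambda>h r. return_pmf (b h r))"

definition complete_history :: "nat \<Rightarrow> nat \<Rightarrow> det_allocation \<Rightarrow> adversary \<Rightarrow> history" where
  "complete_history n m b P =
     (THE h. total_rank n h = m \<and> (\<exists>k. play n m (deterministic b) P k = return_pmf h))"

definition final_load :: "nat \<Rightarrow> nat \<Rightarrow> det_allocation \<Rightarrow> adversary \<Rightarrow> agent_vec" where
  "final_load n m b P = load (complete_history n m b P)"

definition hindsight_loads :: "nat \<Rightarrow> nat \<Rightarrow> det_allocation \<Rightarrow> adversary \<Rightarrow> agent_vec set" where
  "hindsight_loads n m b P =
     (let h = complete_history n m b P in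
      {\<lambda>i. \<Sum>t<length h. z t i | z. \<forall>t<length h. z t \<in> bases n (fst (h ! t))})"

text \<open>The hindsight optimum is only unique up to permutation, hence a predicate.\<close>

definition is_OPT :: "nat \<Rightarrow> nat \<Rightarrow> det_allocation \<Rightarrow> adversary \<Rightarrow> agent_vec \<Rightarrow> bool" where
  "is_OPT n m b P y \<longleftrightarrow>
     y \<in> hindsight_loads n m b P \<and> (\<forall>z \<in> hindsight_loads n m b P. majorizes n z y)"

text \<open>
  The tie-breaking rule is left arbitrary (it may depend on the whole history), except
  for polymatroids of rank 1.
\<close>

definition brick_laying :: "nat \<Rightarrow> det_allocation \<Rightarrow> bool" where
  "brick_laying n b \<longleftrightarrow>
     (\<forall>h r. rank_function n r \<longrightarrow>
        b h r \<in> bases n r \<and>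
        (\<forall>x \<in> bases n r. majorizes n (\<lambda>i. load h i + x i) (\<lambda>i. load h i + b h r i)) \<and>
        (r {1..n} = 1 \<longrightarrow>
           b h r = unit_vec (LEAST i. is_arg_min (load h) (\<lambda>i. unit_vec i \<in> bases n r) i)))"

definition conjugate :: "nat \<Rightarrow> agent_vec \<Rightarrow> nat \<Rightarrow> nat" where
  "conjugate n l j = card {i \<in> {1..n}. l i \<ge> j}"

lemma conjugate_0: "conjugate n l 0 = n"
proof -
  have "{i \<in> {1..n}. l i \<ge> 0} = {1..n}" by auto
  then show ?thesis by (simp add: conjugate_def del: atLeastAtMost_iff)
qed

definition reduced_sequence :: "nat \<Rightarrow> nat \<Rightarrow> agent_vec \<Rightarrow> rank_fun list" where
  "reduced_sequence n m l =
     concat (map (\<lambda>j. replicate (conjugate n l j) (hitting_rank {1..conjugate n l (j - 1)}))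
                 [1..<Suc m])"

text \<open>The value after the end of the sequence is irrelevant, since the game is then over.\<close>

definition fixed_sequence_strategy :: "rank_fun list \<Rightarrow> adversary" where
  "fixed_sequence_strategy rs =
     (\<lambda>h. if length h < length rs then rs ! length h else (\<lambda>A. 0))"

end

theory Submission
  imports Defs
begin

text \<open>
  If Brick-Laying puts units on agents above level \<open>j\<close>, then no feasible exchange could have
  moved them to an agent below level \<open>j\<close>; so in each round there is a tight set containing every
  agent \<open>i\<close> with final load \<open>l i < j\<close> and no agent that received units above level \<open>j\<close>. Hence
  every hindsight load \<open>y\<close> has total at most \<open>\<Sum>i. min (l i) j\<close> on the agents with \<open>l i < j\<close>.
  After sorting the agents by decreasing \<open>l\<close>, these inequalities are Hall's condition for \<open>y\<close> to be
  a hindsight load of the nested sequence, so the optimum of the latter is majorized by \<open>y\<close>. On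
  the nested sequence, Brick-Laying builds up the conjugate of \<open>l\<close> level by level.
\<close>

section \<open>Majorization\<close>

lemma sum_list_increasing_entries:
  "sum_list (map f (increasing_entries n x)) = (\<Sum>i=1..n. f (x i) :: nat)"
proof -
  have "mset (map f (increasing_entries n x)) = mset (map (\<lambda>i. f (x i)) [1..<Suc n])"
    by (simp add: increasing_entries_def multiset.map_comp comp_def del: upt_Suc)
  then have "sum_list (map f (increasing_entries n x)) = sum_list (map (\<lambda>i. f (x i)) [1..<Suc n])"
    by (metis sum_mset_sum_list)
  also have "\<dots> = (\<Sum>i=1..n. f (x i))"
    by (simp only: interv_sum_list_conv_sum_set_nat set_upt atLeastLessThanSuc_atLeastAtMost)
  finally show ?thesis .
qed

lemma length_increasing_entries: "length (increasing_entries n x) = n"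
  by (simp add: increasing_entries_def)

text \<open>Truncated subtraction makes the summand \<open>c - x i\<close> the positive part of the deficit.\<close>

lemma majorizes_deficit:
  assumes "majorizes n x y"
  shows "(\<Sum>i=1..n. c - y i) \<le> (\<Sum>i=1..n. c - x i)"
proof -
  define xs ys where "xs = increasing_entries n x" and "ys = increasing_entries n y"
  \<comment> \<open>With \<open>k\<close> the number of entries of \<open>y\<close> below
    \<open>c\<close>, the deficit of \<open>y\<close> is exactly \<open>k * c\<close> minus the sum
    of its \<open>k\<close> smallest entries. The same expression for \<open>x\<close> is at least
    as large and only bounds the deficit of \<open>x\<close> from below.\<close>
  define k where "k = length (takeWhile (\<lambda>a. a < c) ys)"
  have len: "length xs = n" "length ys = n"
    by (auto simp: xs_def ys_def length_increasing_entries)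
  have kn: "k \<le> n"
    unfolding k_def using len length_takeWhile_le by metis
  have le: "sum_list (take k xs) \<le> sum_list (take k ys)"
    using assms kn by (cases "k = 0") (auto simp: majorizes_def xs_def ys_def)
  have "sorted ys"
    by (simp add: ys_def increasing_entries_def)
  have tk: "take k ys = takeWhile (\<lambda>a. a < c) ys"
    unfolding k_def by (metis takeWhile_eq_take)
  have dk: "drop k ys = dropWhile (\<lambda>a. a < c) ys"
    unfolding k_def by (metis dropWhile_eq_drop)
  have "c \<le> a" if "a \<in> set (drop k ys)" for a
  proof -
    have s: "sorted (drop k ys)"
      using \<open>sorted ys\<close> by (rule sorted_wrt_drop)
    have ne: "drop k ys \<noteq> []"
      using that by auto
    then have "\<not> hd (drop k ys) < c"
      unfolding dk by (rule hd_dropWhile)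
    moreover have "hd (drop k ys) \<le> a"
      using s ne that by (cases "drop k ys") auto
    ultimately show ?thesis by linarith
  qed
  then have "sum_list (map (\<lambda>a. c - a) (drop k ys)) = 0"
    by (auto simp: sum_list_eq_0_iff)
  then have 1: "sum_list (map (\<lambda>a. c - a) ys) = sum_list (map (\<lambda>a. c - a) (take k ys))"
    by (metis append_take_drop_id map_append sum_list_append add_0_right)
  have "\<forall>a\<in>set zs. a < c \<Longrightarrow> sum_list (map (\<lambda>a. c - a) zs) + sum_list zs = length zs * c" for zs
    by (induction zs) auto
  moreover have "\<forall>a\<in>set (take k ys). a < c"
    unfolding tk by (auto dest: set_takeWhileD)
  ultimately have 2: "sum_list (map (\<lambda>a. c - a) (take k ys)) + sum_list (take k ys) = k * c"
    using kn len by simp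
  have "length zs * c \<le> sum_list (map (\<lambda>a. c - a) zs) + sum_list zs" for zs :: "nat list"
    by (induction zs) auto
  from this[of "take k xs"] have 3: "k * c \<le> sum_list (map (\<lambda>a. c - a) (take k xs)) + sum_list (take k xs)"
    using kn len by simp
  have "sum_list (map (\<lambda>a. c - a) (take k xs)) \<le> sum_list (map (\<lambda>a. c - a) xs)"
    by (metis append_take_drop_id map_append sum_list_append le_add1)
  with 1 2 3 le have "sum_list (map (\<lambda>a. c - a) ys) \<le> sum_list (map (\<lambda>a. c - a) xs)"
    by linarith
  then show ?thesis
    unfolding xs_def ys_def sum_list_increasing_entries .
qed

lemma majorizes_trans: "majorizes n x y \<Longrightarrow> majorizes n y z \<Longrightarrow> majorizes n x z"
  unfolding majorizes_def by (auto intro: order_trans)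

lemma majorizes_permuted:
  assumes \<sigma>: "bij_betw \<sigma> {1..n} {1..n}" and eq: "\<And>i. i \<in> {1..n} \<Longrightarrow> x i = y (\<sigma> i)"
  shows "majorizes n x y" "majorizes n y x"
proof -
  have "mset (map x [1..<Suc n]) = image_mset (\<lambda>i. y (\<sigma> i)) (mset_set {1..n})"
    unfolding mset_map mset_upt atLeastLessThanSuc_atLeastAtMost
    by (rule image_mset_cong) (use eq in auto)
  also have "\<dots> = image_mset y (image_mset \<sigma> (mset_set {1..n}))"
    by (simp add: multiset.map_comp comp_def)
  also have "image_mset \<sigma> (mset_set {1..n}) = mset_set {1..n}"
    using \<sigma> by (simp add: image_mset_mset_set bij_betw_def)
  also have "image_mset y (mset_set {1..n}) = mset (map y [1..<Suc n])"
    unfolding mset_map mset_upt atLeastLessThanSuc_atLeastAtMost ..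
  finally have "increasing_entries n x = increasing_entries n y"
    unfolding increasing_entries_def by (metis mset_sort properties_for_sort sorted_sort)
  moreover have "sum x {1..n} = sum y {1..n}"
    using sum.reindex_bij_betw[OF \<sigma>, of y] eq by simp
  ultimately show "majorizes n x y" "majorizes n y x"
    by (simp_all add: majorizes_def)
qed

text \<open>Relabelling the agents by decreasing load turns level sets into initial segments, the
  shape of the sets in the nested sequence.\<close>

lemma ex_sorting_bij:
  fixes l :: agent_vec
  shows "\<exists>\<sigma>. bij_betw \<sigma> {1..n} {1..n} \<and> antimono_on {1..n} (\<lambda>i. l (\<sigma> i))"
proof -
  define xs where "xs = rev (sort_key l [1..<Suc n])"
  have len: "length xs = n" by (simp add: xs_def)
  have "bij_betw (\<lambda>i. xs ! i) {..<n} {1..n}"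
    by (rule bij_betw_nth) (auto simp: xs_def len)
  moreover have "bij_betw (\<lambda>i. i - 1) {1..n} {..<n}"
    by (rule bij_betwI[of _ _ _ Suc]) auto
  ultimately have "bij_betw (\<lambda>i. xs ! (i - 1)) {1..n} {1..n}"
    using bij_betw_trans[of "\<lambda>i. i - 1" "{1..n}" "{..<n}" "\<lambda>i. xs ! i" "{1..n}"]
    by (simp add: comp_def)
  moreover have "antimono_on {1..n} (\<lambda>i. l (xs ! (i - 1)))"
  proof (rule monotone_onI)
    fix i j assume ij: "i \<in> {1..n}" "j \<in> {1..n}" "i \<le> j"
    have "sorted (rev (map l xs))"
      by (simp add: xs_def rev_map)
    then have "map l xs ! (j - 1) \<le> map l xs ! (i - 1)"
      using ij len by (intro sorted_rev_nth_mono) auto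
    then show "l (xs ! (j - 1)) \<le> l (xs ! (i - 1))"
      using ij len by simp
  qed
  ultimately show ?thesis by blast
qed

section \<open>Conjugate vectors\<close>

lemma conjugate_permuted:
  assumes \<sigma>: "bij_betw \<sigma> {1..n} {1..n}"
  shows "conjugate n (\<lambda>i. l (\<sigma> i)) j = conjugate n l j"
proof -
  have "\<sigma> ` {i \<in> {1..n}. j \<le> l (\<sigma> i)} = {i \<in> \<sigma> ` {1..n}. j \<le> l i}"
    by blast
  also have "\<sigma> ` {1..n} = {1..n}"
    using \<sigma> by (rule bij_betw_imp_surj_on)
  finally have "bij_betw \<sigma> {i \<in> {1..n}. j \<le> l (\<sigma> i)} {i \<in> {1..n}. j \<le> l i}"
    by (rule bij_betw_subset[OF \<sigma>, rotated]) blast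
  then show ?thesis
    unfolding conjugate_def by (rule bij_betw_same_card)
qed

lemma conjugate_le: "conjugate n l j \<le> n"
proof -
  have "conjugate n l j \<le> card {1..n}"
    unfolding conjugate_def by (rule card_mono) auto
  then show ?thesis by simp
qed

lemma conjugate_antimono: "j \<le> j' \<Longrightarrow> conjugate n l j' \<le> conjugate n l j"
  unfolding conjugate_def by (rule card_mono) auto

text \<open>The level sets of a decreasing vector are initial segments, hence determined by their
  size. This translates the intervals of the nested sequence into load levels.\<close>

lemma le_conjugate_iff:
  assumes "antimono_on {1..n} l" and i: "i \<in> {1..n}"
  shows "i \<le> conjugate n l j \<longleftrightarrow> j \<le> l i"
proof
  assume "j \<le> l i"
  then have "{1..i} \<subseteq> {i \<in> {1..n}. j \<le> l i}"
    using i monotone_onD[OF assms(1), of _ i] by (auto intro: order_trans)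
  then have "card {1..i} \<le> conjugate n l j"
    unfolding conjugate_def by (rule card_mono[rotated]) auto
  then show "i \<le> conjugate n l j" by simp
next
  assume le: "i \<le> conjugate n l j"
  show "j \<le> l i"
  proof (rule ccontr)
    assume lt: "\<not> j \<le> l i"
    have "i' < i" if "i' \<in> {1..n}" "j \<le> l i'" for i'
      using monotone_onD[OF assms(1) i that(1)] that(2) lt by (meson linorder_le_less_linear order_trans)
    then have "{i \<in> {1..n}. j \<le> l i} \<subseteq> {1..<i}"
      by auto
    then have "conjugate n l j \<le> card {1..<i}"
      unfolding conjugate_def by (rule card_mono[rotated]) auto
    then show False using le i by auto
  qed
qed

text \<open>Double counting of the units at levels up to \<open>k\<close>: by level on the left, by
  agent on the right.\<close>

lemma sum_conjugate: "(\<Sum>j=1..k. conjugate n l j) = (\<Sum>i=1..n. min (l i) k)"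
proof (induction k)
  case (Suc k)
  have "conjugate n l (Suc k) = (\<Sum>i=1..n. of_bool (Suc k \<le> l i))"
    by (simp add: conjugate_def Int_def)
  then have "(\<Sum>j=1..Suc k. conjugate n l j) = (\<Sum>i=1..n. min (l i) k + of_bool (Suc k \<le> l i))"
    using Suc by (simp add: sum.distrib)
  also have "\<dots> = (\<Sum>i=1..n. min (l i) (Suc k))"
    by (rule sum.cong) auto
  finally show ?case .
qed simp

section \<open>Concatenated blocks\<close>

lemma length_concat_replicate:
  "length (concat (map (\<lambda>j. replicate (f j) (g j)) [1..<Suc m])) = sum f {1..m}"
  by (induction m) auto

lemma sum_list_concat_replicate:
  "sum_list (map F (concat (map (\<lambda>j. replicate (f j) (g j)) [1..<Suc m]))) = (\<Sum>j=1..m. f j * (F (g j) :: nat))"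
  by (induction m) (auto simp: sum_list_replicate)

lemma nth_concat_replicate:
  assumes "t < sum f {1..m}"
  shows "\<exists>j\<in>{1..m}. concat (map (\<lambda>j. replicate (f j) (g j)) [1..<Suc m]) ! t = g j \<and>
           sum f {1..j - 1} \<le> t \<and> t < sum f {1..j}"
  using assms
proof (induction m)
  case (Suc m)
  let ?c = "\<lambda>m. concat (map (\<lambda>j. replicate (f j) (g j)) [1..<Suc m])"
  have c: "?c (Suc m) = ?c m @ replicate (f (Suc m)) (g (Suc m))"
    by simp
  show ?case
  proof (cases "t < sum f {1..m}")
    case True
    then obtain j where "j \<in> {1..m}" "?c m ! t = g j" "sum f {1..j - 1} \<le> t" "t < sum f {1..j}"
      using Suc.IH by blast
    moreover have "?c (Suc m) ! t = ?c m ! t"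
      unfolding c using True by (simp only: nth_append length_concat_replicate if_True)
    ultimately show ?thesis by (intro bexI[of _ j]) auto
  next
    case False
    then have "?c (Suc m) ! t = g (Suc m)"
      unfolding c using Suc.prems by (simp only: nth_append length_concat_replicate if_False) auto
    then show ?thesis
      using False Suc.prems by (intro bexI[of _ "Suc m"]) auto
  qed
qed simp

section \<open>Tight sets\<close>

lemma basesD:
  assumes "x \<in> bases n r"
  shows "S \<subseteq> {1..n} \<Longrightarrow> sum x S \<le> r S" "sum x {1..n} = r {1..n}" "i \<notin> {1..n} \<Longrightarrow> x i = 0"
  using assms unfolding bases_def polymatroid_def by auto

text \<open>The sum of \<open>x\<close> is modular and \<open>r\<close> is submodular, so the two
  inequalities that \<open>x\<close> satisfies on union and intersection are squeezed into
  equalities.\<close>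

lemma tight_Un_Int:
  assumes r: "rank_function n r" and x: "x \<in> bases n r"
    and S: "S \<subseteq> {1..n}" "sum x S = r S" and T: "T \<subseteq> {1..n}" "sum x T = r T"
  shows "sum x (S \<union> T) = r (S \<union> T)" "sum x (S \<inter> T) = r (S \<inter> T)"
proof -
  have fin: "finite S" "finite T"
    using S T by (auto intro: finite_subset)
  have "sum x (S \<union> T) + sum x (S \<inter> T) = sum x S + sum x T"
    using fin by (rule sum.union_inter)
  moreover have "r (S \<inter> T) + r (S \<union> T) \<le> r S + r T"
    using r S T unfolding rank_function_def by blast
  moreover have "sum x (S \<union> T) \<le> r (S \<union> T)" "sum x (S \<inter> T) \<le> r (S \<inter> T)"
    using S T by (auto intro!: basesD(1)[OF x])
  ultimately show "sum x (S \<union> T) = r (S \<union> T)" "sum x (S \<inter> T) = r (S \<inter> T)"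
    using S T by linarith+
qed

text \<open>Tight sets form a lattice, so pairwise separation gives a single separating tight set.\<close>

lemma separating_tight_set:
  assumes r: "rank_function n r" and x: "x \<in> bases n r"
    and K: "K \<subseteq> {1..n}" and I: "I \<subseteq> {1..n}"
    and sep: "\<And>k i. k \<in> K \<Longrightarrow> i \<in> I \<Longrightarrow> \<exists>S\<subseteq>{1..n}. sum x S = r S \<and> k \<in> S \<and> i \<notin> S"
  shows "\<exists>S\<subseteq>{1..n}. sum x S = r S \<and> K \<subseteq> S \<and> S \<inter> I = {}"
proof -
  have finK: "finite K" and finI: "finite I"
    using K I by (auto intro: finite_subset)
  \<comment> \<open>For a fixed \<open>i\<close>, the union of the tight sets found for the members
    of \<open>K\<close> still avoids \<open>i\<close>.\<close>
  have one: "\<exists>S\<subseteq>{1..n}. sum x S = r S \<and> K \<subseteq> S \<and> i \<notin> S" if i: "i \<in> I" for i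
    using finK sep
  proof (induction K)
    case empty
    then show ?case using r by (intro exI[of _ "{}"]) (auto simp: rank_function_def)
  next
    case (insert k K)
    obtain S where S: "S \<subseteq> {1..n}" "sum x S = r S" "K \<subseteq> S" "i \<notin> S"
      using insert by blast
    obtain T where T: "T \<subseteq> {1..n}" "sum x T = r T" "k \<in> T" "i \<notin> T"
      using insert.prems[OF _ i] by blast
    have "sum x (S \<union> T) = r (S \<union> T)"
      using tight_Un_Int(1)[OF r x S(1,2) T(1,2)] .
    then show ?case
      using S T by (intro exI[of _ "S \<union> T"]) auto
  qed
  \<comment> \<open>Intersecting over \<open>I\<close> keeps \<open>K\<close> inside; the start is
    \<open>{1..n}\<close>, tight because \<open>x\<close> is a basis.\<close>
  show ?thesis
    using finI one
  proof (induction I)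
    case empty
    then show ?case using K basesD(2)[OF x] by (intro exI[of _ "{1..n}"]) auto
  next
    case (insert i I)
    obtain S where S: "S \<subseteq> {1..n}" "sum x S = r S" "K \<subseteq> S" "S \<inter> I = {}"
      using insert by blast
    obtain T where T: "T \<subseteq> {1..n}" "sum x T = r T" "K \<subseteq> T" "i \<notin> T"
      using insert.prems by blast
    have "sum x (S \<inter> T) = r (S \<inter> T)"
      using tight_Un_Int(2)[OF r x S(1,2) T(1,2)] .
    then show ?case
      using S T by (intro exI[of _ "S \<inter> T"]) auto
  qed
qed

text \<open>Moving a unit from \<open>i\<close> to \<open>k\<close> raises the sum, by one, only on
  sets that contain \<open>k\<close> and not \<open>i\<close>. A constraint violated by the move
  therefore belongs to such a set, and \<open>x\<close> met it with equality.\<close>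

lemma exchange_or_tight:
  assumes x: "x \<in> bases n r" and ik: "i \<in> {1..n}" "k \<in> {1..n}" "i \<noteq> k" "x i > 0"
    and no: "x(i := x i - 1, k := x k + 1) \<notin> bases n r"
  shows "\<exists>S\<subseteq>{1..n}. sum x S = r S \<and> k \<in> S \<and> i \<notin> S"
proof -
  define y where "y = x(i := x i - 1, k := x k + 1)"
  have shift: "sum y S + of_bool (i \<in> S) = sum x S + of_bool (k \<in> S)" if "S \<subseteq> {1..n}" for S
  proof -
    have fin: "finite S" using that by (rule finite_subset) simp
    have "sum y S + of_bool (i \<in> S) = (\<Sum>a\<in>S. y a + of_bool (a = i))"
      using fin by (simp add: sum.distrib)
    also have "\<dots> = (\<Sum>a\<in>S. x a + of_bool (a = k))"
      by (rule sum.cong) (use ik in \<open>auto simp: y_def\<close>)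
    also have "\<dots> = sum x S + of_bool (k \<in> S)"
      using fin by (simp add: sum.distrib)
    finally show ?thesis .
  qed
  have "sum y {1..n} = r {1..n}"
    using shift[of "{1..n}"] ik basesD(2)[OF x] by simp
  moreover have "\<forall>a. a \<notin> {1..n} \<longrightarrow> y a = 0"
    using ik basesD(3)[OF x] by (auto simp: y_def)
  ultimately obtain S where S: "S \<subseteq> {1..n}" "r S < sum y S"
    using no unfolding y_def[symmetric] bases_def polymatroid_def by (auto simp: not_le)
  have "sum x S \<le> r S"
    using basesD(1)[OF x S(1)] .
  with shift[OF S(1)] S(2) have "k \<in> S \<and> i \<notin> S \<and> sum x S = r S"
    by (cases "k \<in> S"; cases "i \<in> S") auto
  with S show ?thesis by blast
qed

section \<open>A round of Brick-Laying\<close>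

lemma brick_layingD:
  assumes "brick_laying n b" "rank_function n r"
  shows "b h r \<in> bases n r"
    "x \<in> bases n r \<Longrightarrow> majorizes n (\<lambda>i. load h i + x i) (\<lambda>i. load h i + b h r i)"
    "r {1..n} = 1 \<Longrightarrow>
      b h r = unit_vec (LEAST i. is_arg_min (load h) (\<lambda>i. unit_vec i \<in> bases n r) i)"
  using assms unfolding brick_laying_def by auto

text \<open>A move from \<open>i\<close> to an agent lower by at least two would strictly decrease a
  deficit, contradicting the majorization-minimal choice.\<close>

lemma brick_laying_no_exchange:
  assumes b: "brick_laying n b" and r: "rank_function n r"
    and ik: "i \<in> {1..n}" "k \<in> {1..n}" "b h r i > 0" "load h k + b h r k + 1 < load h i + b h r i"
  shows "(b h r)(i := b h r i - 1, k := b h r k + 1) \<notin> bases n r"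
proof
  let ?x = "(b h r)(i := b h r i - 1, k := b h r k + 1)"
  \<comment> \<open>At this threshold agent \<open>k\<close> has deficit one before the move and
    none after it, while \<open>i\<close> stays at or above \<open>c\<close> even after losing a
    unit.\<close>
  define c where "c = load h k + b h r k + 1"
  assume "?x \<in> bases n r"
  from brick_layingD(2)[OF b r this]
  have "(\<Sum>a=1..n. c - (load h a + b h r a)) \<le> (\<Sum>a=1..n. c - (load h a + ?x a))"
    by (rule majorizes_deficit)
  moreover have "(\<Sum>a=1..n. c - (load h a + ?x a)) < (\<Sum>a=1..n. c - (load h a + b h r a))"
    by (rule sum_strict_mono_ex1) (use ik in \<open>auto simp: c_def intro!: bexI[of _ k]\<close>)
  ultimately show False by simp
qed

lemma brick_laying_round:
  assumes b: "brick_laying n b" and r: "rank_function n r" and z: "z \<in> bases n r"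
    and K: "K \<subseteq> {1..n}" "\<And>k. k \<in> K \<Longrightarrow> load h k + b h r k < j"
  shows "sum z K \<le> (\<Sum>i=1..n. if load h i + b h r i \<le> j then b h r i else 0)"
proof -
  define x where "x = b h r"
  define I where "I = {i \<in> {1..n}. j < load h i + x i \<and> 0 < x i}"
  have x: "x \<in> bases n r"
    unfolding x_def using brick_layingD(1)[OF b r] .
  have "\<exists>S\<subseteq>{1..n}. sum x S = r S \<and> k \<in> S \<and> i \<notin> S" if "k \<in> K" "i \<in> I" for k i
  proof (rule exchange_or_tight[OF x])
    \<comment> \<open>Since \<open>k\<close> ends below \<open>j\<close> and each \<open>i\<close>
      in \<open>I\<close> above it, their loads differ by at least two, as the exchange argument
      requires.\<close>
    have "load h k + x k < j"
      using K(2) that(1) by (simp add: x_def)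
    then show "i \<in> {1..n}" "k \<in> {1..n}" "i \<noteq> k" "0 < x i"
      using that K by (auto simp: I_def)
    with \<open>load h k + x k < j\<close> that(2) show "x(i := x i - 1, k := x k + 1) \<notin> bases n r"
      unfolding x_def by (intro brick_laying_no_exchange[OF b r]) (auto simp: I_def x_def)
  qed
  then obtain S where S: "S \<subseteq> {1..n}" "sum x S = r S" "K \<subseteq> S" "S \<inter> I = {}"
    using separating_tight_set[OF r x K(1), of I] unfolding I_def by blast
  have finS: "finite S"
    using S(1) by (rule finite_subset) simp
  have "sum z K \<le> sum z S"
    using S finS by (intro sum_mono2) auto
  also have "\<dots> \<le> sum x S"
    using basesD(1)[OF z S(1)] S(2) by simp
  \<comment> \<open>An agent of \<open>S\<close> that received units is not in \<open>I\<close>, so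
    it ends at level at most \<open>j\<close> and the restriction drops nothing.\<close>
  also have "\<dots> = (\<Sum>i\<in>S. if load h i + x i \<le> j then x i else 0)"
    by (rule sum.cong) (use S in \<open>auto simp: I_def disjoint_iff\<close>)
  also have "\<dots> \<le> (\<Sum>i=1..n. if load h i + x i \<le> j then x i else 0)"
    using S(1) by (intro sum_mono2) auto
  finally show ?thesis unfolding x_def .
qed

section \<open>Plays\<close>

lemma load_Nil [simp]: "load [] i = 0"
  and load_snoc [simp]: "load (h @ [(r, x)]) i = load h i + x i"
  by (simp_all add: load_def)

text \<open>Consistency with both strategies, stated without distributions or the stopping rule, so
  that inductions over prefixes need neither.\<close>

definition generated :: "det_allocation \<Rightarrow> adversary \<Rightarrow> history \<Rightarrow> bool" where
  "generated b P h \<longleftrightarrow> (\<forall>t<length h. h ! t = (P (take t h), b (take t h) (P (take t h))))"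

lemma generated_Nil [simp]: "generated b P []"
  by (simp add: generated_def)

lemma generated_snoc [simp]:
  "generated b P (h @ [e]) \<longleftrightarrow> generated b P h \<and> e = (P h, b h (P h))"
  unfolding generated_def by (auto simp: nth_append less_Suc_eq)

lemma play_deterministic:
  "\<exists>h. play n m (deterministic b) P k = return_pmf h \<and> generated b P h \<and>
     (total_rank n h = m \<longrightarrow> (\<forall>k'\<ge>k. play n m (deterministic b) P k' = return_pmf h))"
proof -
  have ex: "\<exists>h. play n m (deterministic b) P k = return_pmf h \<and> generated b P h"
    by (induction k) (auto simp: bind_return_pmf deterministic_def)
  then obtain h where h: "play n m (deterministic b) P k = return_pmf h" "generated b P h"
    by blast
  moreover have "play n m (deterministic b) P k' = return_pmf h" if "total_rank n h = m" "k \<le> k'" for k'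
    using that(2) by (induction rule: dec_induct) (use h that(1) in \<open>auto simp: bind_return_pmf\<close>)
  ultimately show ?thesis by blast
qed

text \<open>A limit of 1 makes the event's probability positive at some round; the play there is a
  point mass, so its history lies in the event.\<close>

lemma complete_historyI:
  assumes "almost_surely n m (deterministic b) P Q"
  shows "total_rank n (complete_history n m b P) = m" "Q (complete_history n m b P)"
    "generated b P (complete_history n m b P)"
proof -
  let ?E = "{h. total_rank n h = m \<and> Q h}"
  let ?p = "play n m (deterministic b) P"
  have "(\<lambda>k. measure_pmf.prob (?p k) ?E) \<longlonglongrightarrow> 1"
    using assms by (simp add: almost_surely_def)
  then have "eventually (\<lambda>k. measure_pmf.prob (?p k) ?E > 0) sequentially"
    by (rule order_tendstoD) simp
  then obtain k where k: "measure_pmf.prob (?p k) ?E > 0"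
    by (auto simp: eventually_sequentially)
  obtain h where h: "?p k = return_pmf h" "generated b P h"
    "total_rank n h = m \<longrightarrow> (\<forall>k'\<ge>k. ?p k' = return_pmf h)"
    using play_deterministic by blast
  have hE: "total_rank n h = m" "Q h"
    using k unfolding h(1) by (auto simp: indicator_def split: if_splits)
  have "complete_history n m b P = h"
    unfolding complete_history_def
  proof (rule the_equality)
    show "total_rank n h = m \<and> (\<exists>k. ?p k = return_pmf h)"
      using h(1) hE by blast
  next
    fix h' assume "total_rank n h' = m \<and> (\<exists>k. ?p k = return_pmf h')"
    then obtain k' where h': "total_rank n h' = m" "?p k' = return_pmf h'" by blast
    obtain g where g: "?p k' = return_pmf g"
      "total_rank n g = m \<longrightarrow> (\<forall>k''\<ge>k'. ?p k'' = return_pmf g)"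
      using play_deterministic by blast
    \<comment> \<open>Completed plays are frozen, so two of them coincide at the later of their
      rounds.\<close>
    have "?p (max k k') = return_pmf h" "?p (max k k') = return_pmf h'"
      using h(3) hE(1) g h' return_pmf_inj by (metis max.cobounded1, metis max.cobounded2)
    then show "h' = h" by simp
  qed
  then show "total_rank n (complete_history n m b P) = m" "Q (complete_history n m b P)"
    "generated b P (complete_history n m b P)"
    using hE h by auto
qed

lemma sum_load:
  assumes "\<forall>(r, x)\<in>set h. x \<in> bases n r"
  shows "sum (load h) {1..n} = total_rank n h"
  using assms
proof (induction h rule: rev_induct)
  case (snoc e h)
  obtain r x where e: "e = (r, x)" by force
  show ?case
    using snoc basesD(2)[of x n r] by (auto simp: e sum.distrib total_rank_def)
qed (simp add: total_rank_def)

lemma generated_bases: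
  assumes b: "brick_laying n b" and g: "generated b P h" and r: "\<forall>(r, x)\<in>set h. rank_function n r"
  shows "\<forall>(r, x)\<in>set h. x \<in> bases n r"
  using g r by (induction h rule: rev_induct) (auto intro: brick_layingD(1)[OF b])

text \<open>This sums \<open>brick_laying_round\<close> over the rounds. Loads only grow, so agents
  of \<open>K\<close> that end below \<open>j\<close> were below \<open>j\<close> after every
  round.\<close>

lemma hindsight_low_agents:
  assumes b: "brick_laying n b" and g: "generated b P h" and r: "\<forall>(r, x)\<in>set h. rank_function n r"
    and z: "\<forall>t<length h. z t \<in> bases n (fst (h ! t))"
    and K: "K \<subseteq> {1..n}" "\<And>k. k \<in> K \<Longrightarrow> load h k < j"
  shows "(\<Sum>i\<in>K. \<Sum>t<length h. z t i) \<le> (\<Sum>i=1..n. min (load h i) j)"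
  using g r z K(2)
proof (induction h rule: rev_induct)
  case (snoc e h)
  let ?x = "b h (P h)"
  have e: "e = (P h, ?x)" and g: "generated b P h"
    using snoc.prems by auto
  have rP: "rank_function n (P h)" and zP: "z (length h) \<in> bases n (P h)"
    using snoc.prems e by auto
  have lt: "load h k + ?x k < j" if "k \<in> K" for k
    using snoc.prems(4)[OF that] by (simp add: e)
  have IH: "(\<Sum>i\<in>K. \<Sum>t<length h. z t i) \<le> (\<Sum>i=1..n. min (load h i) j)"
  proof (rule snoc.IH[OF g])
    show "\<forall>(r, x)\<in>set h. rank_function n r"
      using snoc.prems by auto
    show "\<forall>t<length h. z t \<in> bases n (fst (h ! t))"
      using snoc.prems(3) by (metis length_append_singleton less_SucI nth_append_left)
    show "load h k < j" if "k \<in> K" for k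
      using lt[OF that] by simp
  qed
  have "(\<Sum>i\<in>K. \<Sum>t<length (h @ [e]). z t i) = (\<Sum>i\<in>K. \<Sum>t<length h. z t i) + sum (z (length h)) K"
    by (simp add: sum.distrib)
  also have "\<dots> \<le> (\<Sum>i=1..n. min (load h i) j) +
      (\<Sum>i=1..n. if load h i + ?x i \<le> j then ?x i else 0)"
    using IH brick_laying_round[OF b rP zP K(1) lt] by simp
  also have "\<dots> = (\<Sum>i=1..n. min (load h i) j + (if load h i + ?x i \<le> j then ?x i else 0))"
    by (simp add: sum.distrib)
  \<comment> \<open>Units are counted only when the agent stays at or below \<open>j\<close>, where
    the truncation at \<open>j\<close> is inactive.\<close>
  also have "\<dots> \<le> (\<Sum>i=1..n. min (load (h @ [e]) i) j)"
    by (rule sum_mono) (auto simp: e)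
  finally show ?case .
qed simp

section \<open>Fixed sequences of rank-one polymatroids\<close>

text \<open>Every rank is 1, so the total rank is the number of rounds played and the game stops
  exactly when the list is exhausted.\<close>

lemma play_fixed_sequence:
  assumes rs: "length rs = m" "\<forall>r\<in>set rs. r {1..n} = 1"
    and h: "h \<in> set_pmf (play n m A (fixed_sequence_strategy rs) k)"
  shows "map fst h = take k rs"
  using h
proof (induction k arbitrary: h)
  case (Suc k)
  obtain h0 where h0: "h0 \<in> set_pmf (play n m A (fixed_sequence_strategy rs) k)"
    and h: "h \<in> set_pmf (if total_rank n h0 = m then return_pmf h0
      else map_pmf (\<lambda>x. h0 @ [(fixed_sequence_strategy rs h0, x)]) (A h0 (fixed_sequence_strategy rs h0)))"
    using Suc.prems by (auto simp del: set_map_pmf)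
  have fst0: "map fst h0 = take k rs"
    using Suc.IH[OF h0] .
  have "total_rank n h0 = sum_list (map (\<lambda>r. r {1..n}) (map fst h0))"
    by (simp add: total_rank_def case_prod_unfold comp_def)
  also have "\<dots> = sum_list (map (\<lambda>r. 1) (take k rs))"
    unfolding fst0 by (rule arg_cong[where f = sum_list], rule map_cong) (use rs in \<open>auto dest: in_set_takeD\<close>)
  also have "\<dots> = min k m"
    using rs by (simp add: sum_list_triv min.commute)
  finally have tr: "total_rank n h0 = min k m" .
  have len: "length h0 = min k m"
    using arg_cong[OF fst0, of length] rs by (simp add: min.commute)
  show ?case
  proof (cases "k < m")
    case True
    then have "map fst h = take k rs @ [rs ! k]"
      using h tr len fst0 rs by (auto simp: fixed_sequence_strategy_def)
    then show ?thesis
      using True rs by (simp add: take_Suc_conv_app_nth)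
  next
    case False
    then show ?thesis
      using h tr fst0 rs by simp
  qed
qed simp

lemma total_rank_fixed_sequence:
  assumes "\<forall>r\<in>set rs. r {1..n} = 1" "map fst h = rs"
  shows "total_rank n h = length rs"
  using assms by (induction h arbitrary: rs) (auto simp: total_rank_def)

lemma almost_surely_fixed_sequence:
  assumes rs: "length rs = m" "\<forall>r\<in>set rs. r {1..n} = 1"
    and Q: "\<And>h. map fst h = rs \<Longrightarrow> Q h"
  shows "almost_surely n m A (fixed_sequence_strategy rs) Q"
proof -
  have "measure_pmf.prob (play n m A (fixed_sequence_strategy rs) k) {h. total_rank n h = m \<and> Q h} = 1"
    if "m \<le> k" for k
  proof -
    have "total_rank n h = m \<and> Q h"
      if "h \<in> set_pmf (play n m A (fixed_sequence_strategy rs) k)" for h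
    proof -
      have "map fst h = rs"
        using play_fixed_sequence[OF rs that] \<open>m \<le> k\<close> rs by simp
      then show ?thesis
        using Q total_rank_fixed_sequence[OF rs(2)] rs(1) by blast
    qed
    then show ?thesis
      by (subst measure_pmf.prob_eq_1) (auto simp: AE_measure_pmf_iff)
  qed
  then have "eventually (\<lambda>k. measure_pmf.prob (play n m A (fixed_sequence_strategy rs) k)
      {h. total_rank n h = m \<and> Q h} = 1) sequentially"
    by (auto simp: eventually_sequentially)
  then show ?thesis
    unfolding almost_surely_def by (rule tendsto_eventually)
qed

lemma rank_function_hitting_rank: "N \<subseteq> {1..n} \<Longrightarrow> rank_function n (hitting_rank N)"
  unfolding rank_function_def hitting_rank_def by auto

lemma unit_vec_in_bases_hitting_rank:
  assumes "p \<le> n"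
  shows "unit_vec i \<in> bases n (hitting_rank {1..p}) \<longleftrightarrow> i \<in> {1..p}"
proof
  assume u: "unit_vec i \<in> bases n (hitting_rank {1..p})"
  have i: "i \<in> {1..n}"
    using basesD(3)[OF u, of i] by (auto simp: unit_vec_def)
  then show "i \<in> {1..p}"
    using basesD(1)[OF u, of "{i}"] by (auto simp: unit_vec_def hitting_rank_def split: if_splits)
next
  assume i: "i \<in> {1..p}"
  have s: "sum (unit_vec i) A = of_bool (i \<in> A)" if "A \<subseteq> {1..n}" for A
    using finite_subset[OF that] by (simp add: unit_vec_def)
  show "unit_vec i \<in> bases n (hitting_rank {1..p})"
    unfolding bases_def polymatroid_def using i assms s
    by (auto simp: hitting_rank_def unit_vec_def)
qed

text \<open>The starting history is a parameter so that runs compose along concatenated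
  blocks.\<close>

definition run :: "det_allocation \<Rightarrow> history \<Rightarrow> rank_fun list \<Rightarrow> history" where
  "run b = foldl (\<lambda>h r. h @ [(r, b h r)])"

lemma generated_fixed_sequence:
  assumes "generated b (fixed_sequence_strategy rs) h" "map fst h = take (length h) rs"
    "length h \<le> length rs"
  shows "h = run b [] (take (length h) rs)"
  using assms
proof (induction h rule: rev_induct)
  case (snoc e h)
  have e: "e = (rs ! length h, b h (rs ! length h))"
    using snoc.prems by (simp add: fixed_sequence_strategy_def)
  have tk: "take (Suc (length h)) rs = take (length h) rs @ [rs ! length h]"
    using snoc.prems by (simp add: take_Suc_conv_app_nth)
  have "h = run b [] (take (length h) rs)"
    using snoc.prems tk by (intro snoc.IH) auto
  then show ?case
    using e by (simp add: tk run_def)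
qed (simp add: run_def)

text \<open>From a flat load on \<open>{1..p}\<close>, the lowest-index rule serves agents
  \<open>1\<close>, ..., \<open>q\<close> once each; \<open>q \<le> p\<close> prevents a second
  pass.\<close>

lemma run_phase:
  assumes b: "brick_laying n b" and p: "p \<le> n" and q: "q \<le> p"
    and c: "\<And>i. i \<in> {1..p} \<Longrightarrow> load h i = c"
  shows "load (run b h (replicate q (hitting_rank {1..p}))) i = load h i + of_bool (i \<in> {1..q})"
  using q
proof (induction q arbitrary: i)
  case (Suc q)
  define r where "r = hitting_rank {1..p}"
  define g where "g = run b h (replicate q r)"
  have load: "load g i = load h i + of_bool (i \<in> {1..q})" for i
    using Suc by (simp add: g_def r_def)
  have "run b h (replicate (Suc q) r) = g @ [(r, b g r)]"
    unfolding g_def run_def replicate_Suc replicate_append_same[symmetric] by simp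
  moreover have "b g r = unit_vec (Suc q)"
  proof -
    have "r {1..n} = 1"
      using Suc.prems p by (auto simp: r_def hitting_rank_def)
    then have "b g r = unit_vec (LEAST i. is_arg_min (load g) (\<lambda>i. unit_vec i \<in> bases n r) i)"
      using p unfolding r_def by (intro brick_layingD(3)[OF b rank_function_hitting_rank]) auto
    also have "(\<lambda>i. unit_vec i \<in> bases n r) = (\<lambda>i. i \<in> {1..p})"
      unfolding r_def using unit_vec_in_bases_hitting_rank[OF p] by auto
    \<comment> \<open>After \<open>q\<close> units the agents up to \<open>q\<close> stand at
      \<open>c + 1\<close> and the others up to \<open>p\<close> still at \<open>c\<close>.\<close>
    also have "is_arg_min (load g) (\<lambda>i. i \<in> {1..p}) = (\<lambda>i. i \<in> {Suc q..p})"
    proof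
      fix i
      have "\<not> is_arg_min (load g) (\<lambda>i. i \<in> {1..p}) i" if "i \<in> {1..q}"
        using that Suc.prems c by (auto simp: is_arg_min_def load intro!: exI[of _ "Suc q"])
      moreover have "is_arg_min (load g) (\<lambda>i. i \<in> {1..p}) i" if "i \<in> {Suc q..p}"
        using that c by (auto simp: is_arg_min_def load)
      moreover have "i \<in> {1..p}" if "is_arg_min (load g) (\<lambda>i. i \<in> {1..p}) i"
        using that by (simp add: is_arg_min_def)
      ultimately show "is_arg_min (load g) (\<lambda>i. i \<in> {1..p}) i = (i \<in> {Suc q..p})"
        by (metis atLeastAtMost_iff not_less_eq_eq)
    qed
    also have "(LEAST i. i \<in> {Suc q..p}) = Suc q"
      using Suc.prems by (intro Least_equality) auto
    finally show ?thesis .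
  qed
  ultimately show ?case
    unfolding r_def[symmetric] by (auto simp: load unit_vec_def)
qed (simp add: run_def)

text \<open>Each block of the sequence adds one level. The number of blocks \<open>k\<close> varies
  independently of \<open>l\<close>, which permits induction over the levels.\<close>

lemma run_reduced_sequence:
  assumes b: "brick_laying n b" and l: "antimono_on {1..n} l" and i: "i \<in> {1..n}"
  shows "load (run b [] (reduced_sequence n k l)) i = min (l i) k"
  using i
proof (induction k arbitrary: i)
  case 0
  then show ?case by (simp add: reduced_sequence_def run_def)
next
  case (Suc k)
  let ?h = "run b [] (reduced_sequence n k l)"
  have "run b [] (reduced_sequence n (Suc k) l) =
      run b ?h (replicate (conjugate n l (Suc k)) (hitting_rank {1..conjugate n l k}))"
    by (simp add: reduced_sequence_def run_def)
  \<comment> \<open>Block \<open>Suc k\<close> offers exactly the agents with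
    \<open>l i \<ge> k\<close>; all of them stand at level \<open>k\<close>, so
    \<open>run_phase\<close> applies.\<close>
  moreover have "load ?h i = k" if "i \<in> {1..conjugate n l k}" for i
  proof -
    have "i \<in> {1..n}" using that conjugate_le[of n l k] by auto
    then show ?thesis
      using Suc.IH le_conjugate_iff[OF l] that by simp
  qed
  ultimately have "load (run b [] (reduced_sequence n (Suc k) l)) i =
      load ?h i + of_bool (i \<in> {1..conjugate n l (Suc k)})"
    using run_phase[OF b conjugate_le conjugate_antimono] by simp
  then show ?case
    using Suc le_conjugate_iff[OF l Suc.prems, of "Suc k"] by auto
qed

section \<open>The reduction\<close>

lemma nth_reduced_sequence:
  assumes "t < (\<Sum>j=1..m. conjugate n l j)"
  obtains j where "j \<in> {1..m}" "reduced_sequence n m l ! t = hitting_rank {1..conjugate n l (j - 1)}"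
    "(\<Sum>j'=1..j - 1. conjugate n l j') \<le> t" "t < (\<Sum>j'=1..j. conjugate n l j')"
  using nth_concat_replicate[OF assms, of "\<lambda>j. hitting_rank {1..conjugate n l (j - 1)}"]
  unfolding reduced_sequence_def by blast

lemma length_reduced_sequence: "length (reduced_sequence n m l) = (\<Sum>j=1..m. conjugate n l j)"
  unfolding reduced_sequence_def by (rule length_concat_replicate)

lemma reduced_sequence_rank_one:
  assumes "r \<in> set (reduced_sequence n m l)"
  shows "rank_function n r" "r {1..n} = 1"
proof -
  \<comment> \<open>A copy occurs only in a nonempty block, and antitonicity of the conjugate then
    makes the offered interval nonempty.\<close>
  obtain j where j: "conjugate n l j > 0" "r = hitting_rank {1..conjugate n l (j - 1)}"
    using assms by (auto simp: reduced_sequence_def simp del: upt_Suc)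
  show "rank_function n r"
    using j(2) conjugate_le[of n l "j - 1"] by (auto intro: rank_function_hitting_rank)
  show "r {1..n} = 1"
    using j conjugate_le[of n l "j - 1"] conjugate_antimono[of "j - 1" j n l]
    by (auto simp: hitting_rank_def)
qed

lemma reduced_sequence_nested:
  assumes M: "M = (\<Sum>j=1..m. conjugate n l j)"
  shows "\<exists>N. (\<forall>t<M. N t \<subseteq> {1..n} \<and> reduced_sequence n m l ! t = hitting_rank (N t)) \<and>
             (\<forall>s t. s \<le> t \<and> t < M \<longrightarrow> N t \<subseteq> N s)"
proof -
  have "\<exists>j. reduced_sequence n m l ! t = hitting_rank {1..conjugate n l (j - 1)} \<and>
      (\<Sum>j'=1..j - 1. conjugate n l j') \<le> t \<and> t < (\<Sum>j'=1..j. conjugate n l j')"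
    if "t < M" for t
    using nth_reduced_sequence[of t n l m] that unfolding M by metis
  then obtain J where J: "reduced_sequence n m l ! t = hitting_rank {1..conjugate n l (J t - 1)}"
      "(\<Sum>j'=1..J t - 1. conjugate n l j') \<le> t" "t < (\<Sum>j'=1..J t. conjugate n l j')"
    if "t < M" for t
    by metis
  \<comment> \<open>If round \<open>t\<close> lay in an earlier block than \<open>s\<close>, the
    partial sums bounding the two blocks would force \<open>t < s\<close>.\<close>
  have mono: "J s - 1 \<le> J t - 1" if "s \<le> t" "t < M" for s t
  proof (rule ccontr)
    assume "\<not> J s - 1 \<le> J t - 1"
    then have "(\<Sum>j'=1..J t. conjugate n l j') \<le> (\<Sum>j'=1..J s - 1. conjugate n l j')"
      by (intro sum_mono2) auto
    then show False
      using J(2)[of s] J(3)[of t] that by linarith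
  qed
  show ?thesis
  proof (intro exI conjI allI impI)
    fix t assume t: "t < M"
    show "{1..conjugate n l (J t - 1)} \<subseteq> {1..n}"
      using conjugate_le[of n l "J t - 1"] by auto
    show "reduced_sequence n m l ! t = hitting_rank {1..conjugate n l (J t - 1)}"
      using J(1)[OF t] .
  next
    fix s t assume "s \<le> t \<and> t < M"
    then show "{1..conjugate n l (J t - 1)} \<subseteq> {1..conjugate n l (J s - 1)}"
      using conjugate_antimono[OF mono, of s t n l] by auto
  qed
qed

text \<open>Hall's condition for the nested intervals; the witness serves the agents in decreasing order.\<close>

lemma reduced_sequence_hindsight:
  assumes w: "sum w {1..n} = (\<Sum>j=1..m. conjugate n l j)"
    and hall: "\<And>j. (\<Sum>i=conjugate n l j + 1..n. w i) \<le> (\<Sum>j'=1..j. conjugate n l j')"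
  shows "\<exists>z. (\<forall>t < sum w {1..n}. z t \<in> bases n (reduced_sequence n m l ! t)) \<and>
             (\<forall>i\<in>{1..n}. (\<Sum>t < sum w {1..n}. z t i) = w i)"
proof -
  \<comment> \<open>High indices are the first to leave the shrinking intervals, so the agents are
    listed from \<open>n\<close> down to \<open>1\<close>, agent \<open>i\<close> repeated
    \<open>w i\<close> times.\<close>
  define as where "as = concat (map (\<lambda>j. replicate (w (n + 1 - j)) (n + 1 - j)) [1..<Suc n])"
  have rev_sum: "(\<Sum>j=1..k. f (n + 1 - j)) = sum f {n + 1 - k..n}" if "k \<le> n" for k and f :: "nat \<Rightarrow> nat"
    by (rule sum.reindex_bij_witness[of _ "\<lambda>i. n + 1 - i" "\<lambda>i. n + 1 - i"]) (use that in auto)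
  have len: "length as = sum w {1..n}"
    unfolding as_def length_concat_replicate using rev_sum[of n w] by simp
  have count: "(\<Sum>t < sum w {1..n}. unit_vec (as ! t) i) = w i" if i: "i \<in> {1..n}" for i
  proof -
    have "(\<Sum>t < sum w {1..n}. unit_vec (as ! t) i) = sum_list (map (\<lambda>a. unit_vec a i) as)"
      by (simp add: sum_list_sum_nth len atLeast0LessThan)
    also have "\<dots> = (\<Sum>j=1..n. w (n + 1 - j) * unit_vec (n + 1 - j) i)"
      unfolding as_def by (rule sum_list_concat_replicate)
    also have "\<dots> = (\<Sum>a=1..n. w a * unit_vec a i)"
      using rev_sum[of n "\<lambda>a. w a * unit_vec a i"] by simp
    also have "\<dots> = (\<Sum>a=1..n. if a = i then w a else 0)"
      by (rule sum.cong) (auto simp: unit_vec_def)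
    also have "\<dots> = w i"
      using i by simp
    finally show ?thesis .
  qed
  have "unit_vec (as ! t) \<in> bases n (reduced_sequence n m l ! t)" if t: "t < sum w {1..n}" for t
  proof -
    obtain j where j: "reduced_sequence n m l ! t = hitting_rank {1..conjugate n l (j - 1)}"
      "(\<Sum>j'=1..j - 1. conjugate n l j') \<le> t"
      using nth_reduced_sequence t unfolding w by metis
    have "t < (\<Sum>j=1..n. w (n + 1 - j))"
      using t rev_sum[of n w] by simp
    from nth_concat_replicate[OF this, of "\<lambda>j. n + 1 - j"]
    obtain k where k: "k \<in> {1..n}" "as ! t = n + 1 - k" "t < (\<Sum>j=1..k. w (n + 1 - j))"
      unfolding as_def by blast
    have ta: "t < sum w {as ! t..n}"
      using k rev_sum[of k w] by simp
    \<comment> \<open>Otherwise all agents from \<open>as ! t\<close> to \<open>n\<close> lie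
      outside the interval of block \<open>j\<close>. Hall's condition then bounds their total by
      the length of the first \<open>j - 1\<close> blocks, hence by \<open>t\<close>, although
      position \<open>t\<close> still lies within that total.\<close>
    have "as ! t \<le> conjugate n l (j - 1)"
    proof (rule ccontr)
      assume "\<not> ?thesis"
      then have "sum w {as ! t..n} \<le> (\<Sum>i=conjugate n l (j - 1) + 1..n. w i)"
        by (intro sum_mono2) auto
      then show False
        using ta j(2) hall[of "j - 1"] by linarith
    qed
    moreover have "1 \<le> as ! t"
      using k by auto
    ultimately show ?thesis
      unfolding j(1) unit_vec_in_bases_hitting_rank[OF conjugate_le] by simp
  qed
  with count show ?thesis
    by (intro exI[of _ "\<lambda>t. unit_vec (as ! t)"]) auto
qed

theorem lemma1:
  fixes n m :: nat and BL :: det_allocation and P P' :: adversary and l :: agent_vec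
  assumes BL: "brick_laying n BL"
    and P: "P \<in> adversarial_strategies n m"
    and l: "l = final_load n m BL P"
    and P': "P' = fixed_sequence_strategy (reduced_sequence n m l)"
  shows "P' \<in> adversarial_strategies n m \<and>
         nested_strategy n m P' \<and>
         majorization_equiv n (final_load n m BL P) (final_load n m BL P') \<and>
         (\<forall>opt opt'. is_OPT n m BL P opt \<and> is_OPT n m BL P' opt' \<longrightarrow> majorizes n opt opt')"
proof -
  define h where "h = complete_history n m BL P"
  define h' where "h' = complete_history n m BL P'"
  define rs where "rs = reduced_sequence n m l"
  have "deterministic BL \<in> allocation_strategies n"
    using brick_layingD(1)[OF BL] by (auto simp: allocation_strategies_def deterministic_def)
  then have as: "almost_surely n m (deterministic BL) P (\<lambda>h. \<forall>(r, x)\<in>set h. rank_function n r)"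
    using P by (auto simp: adversarial_strategies_def)
  have h: "total_rank n h = m" "\<forall>(r, x)\<in>set h. rank_function n r" "generated BL P h"
    unfolding h_def using complete_historyI[OF as] by auto
  have lh: "l = load h"
    by (simp add: l final_load_def h_def)
  have suml: "sum l {1..n} = m"
    unfolding lh using sum_load[OF generated_bases[OF BL h(3,2)]] h(1) by simp
  have le_m: "l i \<le> m" if "i \<in> {1..n}" for i
    using member_le_sum[OF that, of l] suml by simp
  \<comment> \<open>No load exceeds \<open>m\<close>, so truncating at level \<open>m\<close> loses
    nothing and the nested sequence has exactly \<open>m\<close> rounds.\<close>
  have sum_conj: "(\<Sum>j=1..m. conjugate n l j) = m"
    unfolding sum_conjugate using le_m suml by (simp add: min_absorb1)
  have len: "length rs = m"
    unfolding rs_def length_reduced_sequence sum_conj ..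
  have rank1: "\<forall>r\<in>set rs. r {1..n} = 1"
    unfolding rs_def using reduced_sequence_rank_one(2) by blast
  have P'_rs: "P' = fixed_sequence_strategy rs"
    by (simp add: P' rs_def)

  \<comment> \<open>Admissibility and nestedness of the new strategy\<close>
  have adv: "P' \<in> adversarial_strategies n m"
    unfolding adversarial_strategies_def P'_rs mem_Collect_eq
  proof (intro ballI almost_surely_fixed_sequence[OF len rank1])
    fix h r assume "map fst h = rs" "r \<in> set h"
    then have "fst r \<in> set rs" by force
    then show "case r of (r, x) \<Rightarrow> rank_function n r"
      using reduced_sequence_rank_one(1) unfolding rs_def by (cases r) auto
  qed
  have nested: "nested_strategy n m P'"
    unfolding nested_strategy_def P'_rs
  proof (intro ballI almost_surely_fixed_sequence[OF len rank1])
    fix h :: history assume eq: "map fst h = rs"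
    then have "length h = m" "\<forall>t<m. fst (h ! t) = rs ! t"
      using len by (metis length_map nth_map)+
    then show "length h = m \<and> (\<exists>N. (\<forall>t<m. N t \<subseteq> {1..n} \<and> fst (h ! t) = hitting_rank (N t)) \<and>
        (\<forall>s t. s \<le> t \<and> t < m \<longrightarrow> N t \<subseteq> N s))"
      using reduced_sequence_nested[OF sum_conj[symmetric]] unfolding rs_def[symmetric] by auto
  qed

  \<comment> \<open>The Brick-Laying load on the nested sequence\<close>
  have as': "almost_surely n m (deterministic BL) P' (\<lambda>h. map fst h = rs)"
    unfolding P'_rs by (rule almost_surely_fixed_sequence[OF len rank1])
  have h': "map fst h' = rs" "generated BL P' h'"
    unfolding h'_def using complete_historyI[OF as'] by auto
  have len': "length h' = m"
    using h'(1) len by (metis length_map)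

  obtain \<sigma> where \<sigma>: "bij_betw \<sigma> {1..n} {1..n}" "antimono_on {1..n} (\<lambda>i. l (\<sigma> i))"
    using ex_sorting_bij by blast
  \<comment> \<open>The nested sequence depends on \<open>l\<close> only through its conjugate, so
    it is also the sequence of the sorted load, to which \<open>run_reduced_sequence\<close>
    applies.\<close>
  define \<mu> where "\<mu> = (\<lambda>i. l (\<sigma> i))"
  have conj: "conjugate n \<mu> = conjugate n l"
    unfolding \<mu>_def using conjugate_permuted[OF \<sigma>(1)] by blast
  then have rs_\<mu>: "rs = reduced_sequence n m \<mu>"
    by (simp add: rs_def reduced_sequence_def)
  have "h' = run BL [] rs"
    using generated_fixed_sequence[of BL rs h'] h' len len' by (simp add: P'_rs)
  then have load': "load h' i = l (\<sigma> i)" if "i \<in> {1..n}" for i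
    using run_reduced_sequence[OF BL, of \<mu> i m] \<sigma> that le_m[of "\<sigma> i"] bij_betwE[OF \<sigma>(1)]
    by (simp add: rs_\<mu> \<mu>_def)
  have equiv: "majorization_equiv n (final_load n m BL P) (final_load n m BL P')"
    using majorizes_permuted[OF \<sigma>(1), of "load h'" l] load'
    by (simp add: majorization_equiv_def l[symmetric] final_load_def[of n m BL P'] h'_def[symmetric])

  \<comment> \<open>Comparison of the hindsight optima\<close>
  have "majorizes n opt opt'" if opt: "is_OPT n m BL P opt" and opt': "is_OPT n m BL P' opt'" for opt opt'
  proof -
    obtain z where z: "\<forall>t<length h. z t \<in> bases n (fst (h ! t))" "opt = (\<lambda>i. \<Sum>t<length h. z t i)"
      using opt unfolding is_OPT_def hindsight_loads_def h_def[symmetric] Let_def by blast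
    define w where "w = (\<lambda>i. opt (\<sigma> i))"
    have sum_opt: "sum opt {1..n} = m"
    proof -
      have "sum opt {1..n} = (\<Sum>t<length h. sum (z t) {1..n})"
        unfolding z(2) by (rule sum.swap)
      also have "\<dots> = (\<Sum>t<length h. fst (h ! t) {1..n})"
        by (rule sum.cong) (use z(1) basesD(2) in auto)
      also have "\<dots> = total_rank n h"
        by (simp add: total_rank_def sum_list_sum_nth atLeast0LessThan case_prod_unfold)
      finally show ?thesis using h(1) by simp
    qed
    have w_m: "sum w {1..n} = m"
      unfolding w_def using sum.reindex_bij_betw[OF \<sigma>(1), of opt] sum_opt by simp
    \<comment> \<open>In sorted order the tail past \<open>conjugate n l j\<close> consists of the
      agents with load below \<open>j\<close>, so the bound is \<open>hindsight_low_agents\<close>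
      read through \<open>sum_conjugate\<close>.\<close>
    have hall: "(\<Sum>i=conjugate n l j + 1..n. w i) \<le> (\<Sum>j'=1..j. conjugate n l j')" for j
    proof -
      have img: "\<sigma> ` {conjugate n l j + 1..n} = {i \<in> {1..n}. l i < j}" (is "\<sigma> ` ?A = ?K")
      proof -
        have "i \<le> conjugate n l j \<longleftrightarrow> j \<le> l (\<sigma> i)" if "i \<in> {1..n}" for i
          using le_conjugate_iff[OF \<sigma>(2) that] conj unfolding \<mu>_def by simp
        then have "conjugate n l j < i \<longleftrightarrow> l (\<sigma> i) < j" if "i \<in> {1..n}" for i
          using that by (meson not_le)
        moreover have "?A = {i \<in> {1..n}. conjugate n l j < i}"
          by auto
        ultimately have "?A = {i \<in> {1..n}. l (\<sigma> i) < j}"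
          by blast
        also have "\<sigma> ` \<dots> = {i \<in> \<sigma> ` {1..n}. l i < j}"
          by blast
        also have "\<sigma> ` {1..n} = {1..n}"
          using \<sigma>(1) by (rule bij_betw_imp_surj_on)
        finally show ?thesis .
      qed
      have "inj_on \<sigma> ?A"
        using \<sigma>(1) unfolding bij_betw_def by (auto intro: inj_on_subset)
      then have "sum w ?A = sum opt ?K"
        unfolding w_def img[symmetric] by (simp add: sum.reindex)
      also have "\<dots> \<le> (\<Sum>i=1..n. min (l i) j)"
        unfolding z(2) lh by (rule hindsight_low_agents[OF BL h(3,2) z(1)]) auto
      finally show ?thesis
        unfolding sum_conjugate .
    qed
    have "sum w {1..n} = (\<Sum>j=1..m. conjugate n l j)"
      using w_m sum_conj by simp
    from reduced_sequence_hindsight[OF this hall]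
    obtain z' where z': "\<forall>t<m. z' t \<in> bases n (rs ! t)" "\<forall>i\<in>{1..n}. (\<Sum>t<m. z' t i) = w i"
      unfolding w_m rs_def by blast
    \<comment> \<open>This hindsight load of the nested sequence is a permutation of
      \<open>opt\<close> on \<open>{1..n}\<close>, and it majorizes \<open>opt'\<close> by
      optimality.\<close>
    define w' where "w' = (\<lambda>i. \<Sum>t<m. z' t i)"
    have "\<forall>t<m. z' t \<in> bases n (fst (h' ! t))"
      using z'(1) h'(1) len' by (metis nth_map)
    then have "w' \<in> hindsight_loads n m BL P'"
      unfolding hindsight_loads_def h'_def[symmetric] Let_def len' w'_def by blast
    then have "majorizes n w' opt'"
      using opt' by (simp add: is_OPT_def)
    moreover have "majorizes n opt w'"
      using z'(2) by (intro majorizes_permuted(2)[OF \<sigma>(1)]) (auto simp: w'_def w_def)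
    ultimately show ?thesis
      by (rule majorizes_trans[rotated])
  qed
  with adv nested equiv show ?thesis by blast
qed

end
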